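(* Let $V$ be a variety of universal algebras and let $F$ be the free algebra of $V$ freely generated by $X=\{x_1,\dots,x_n\}$. Let $P$ be the subgroup of $\mathrm{Aut}(F)$ consisting of all automorphisms $\gamma$ of $F$ with $\gamma(X)=X$. For any automorphism $\Phi$ of the semigroup $\mathrm{End}(F)$ the following conditions are equivalent: 1) $\Phi$ is quasi-inner; 2) $\Phi$ acts on the group $P$ in the inner way, that is, there exists an automorphism $\sigma$ of $F$ such that $\Phi(\gamma)=\sigma\circ\gamma\circ\sigma^{-1}$ for every $\gamma\in P$; 3) there exists a basis $\tilde X$ of $F$ with the same number $n$ of elements such that $\Phi(\gamma)(\tilde X)=\tilde X$ for all $\gamma\in P$.
   Context: $\mathrm{End}(F)$ is the semigroup of all endomorphisms of $F$ under composition. An automorphism $\Phi$ of $\mathrm{End}(F)$ is quasi-inner if there is a bijection $s$ of the set $F$ onto itself such that $\Phi(\nu)=s\circ\nu\circ s^{-1}$ for every endomorphism $\nu$ of $F$. A basis of $F$ is a free generating set of $F$ (relative to $V$). *)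

theory Defs
  imports "HOL-Algebra.Group"
begin

record ('a, 'f) algebra = "'a partial_object" +
  interp :: "'f \<Rightarrow> 'a list \<Rightarrow> 'a"

definition is_algebra :: "('f \<Rightarrow> nat) \<Rightarrow> ('a, 'f) algebra \<Rightarrow> bool" where
  "is_algebra ar A \<longleftrightarrow>
     (\<forall>f as. length as = ar f \<and> set as \<subseteq> carrier A \<longrightarrow> interp A f as \<in> carrier A)"

(* Homomorphisms are extensional: they take the value undefined off the carrier,
   so equality of homomorphisms is equality of HOL functions. *)
definition alg_hom ::
  "('f \<Rightarrow> nat) \<Rightarrow> ('a, 'f) algebra \<Rightarrow> ('b, 'f) algebra \<Rightarrow> ('a \<Rightarrow> 'b) set" where
  "alg_hom ar A B =
     {h \<in> carrier A \<rightarrow>\<^sub>E carrier B.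
        \<forall>f as. length as = ar f \<and> set as \<subseteq> carrier A \<longrightarrow>
          h (interp A f as) = interp B f (map h as)}"

definition subuniverse :: "('f \<Rightarrow> nat) \<Rightarrow> ('a, 'f) algebra \<Rightarrow> 'a set \<Rightarrow> bool" where
  "subuniverse ar A S \<longleftrightarrow>
     S \<subseteq> carrier A \<and> (\<forall>f as. length as = ar f \<and> set as \<subseteq> S \<longrightarrow> interp A f as \<in> S)"

definition generates :: "('f \<Rightarrow> nat) \<Rightarrow> ('a, 'f) algebra \<Rightarrow> 'a set \<Rightarrow> bool" where
  "generates ar A X \<longleftrightarrow>
     X \<subseteq> carrier A \<and> (\<forall>S. subuniverse ar A S \<and> X \<subseteq> S \<longrightarrow> S = carrier A)"

datatype (vars: 'v, syms: 'f) trm = Var 'v | App 'f "('v, 'f) trm list"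

fun wf_trm :: "('f \<Rightarrow> nat) \<Rightarrow> ('v, 'f) trm \<Rightarrow> bool" where
  "wf_trm ar (Var x) \<longleftrightarrow> True"
| "wf_trm ar (App f ts) \<longleftrightarrow> length ts = ar f \<and> (\<forall>t \<in> set ts. wf_trm ar t)"

fun term_val :: "('a, 'f) algebra \<Rightarrow> ('v \<Rightarrow> 'a) \<Rightarrow> ('v, 'f) trm \<Rightarrow> 'a" where
  "term_val A \<rho> (Var x) = \<rho> x"
| "term_val A \<rho> (App f ts) = interp A f (map (term_val A \<rho>) ts)"

type_synonym 'f identity = "(nat, 'f) trm \<times> (nat, 'f) trm"

definition identities :: "('f \<Rightarrow> nat) \<Rightarrow> 'f identity set" where
  "identities ar = {(l, r). wf_trm ar l \<and> wf_trm ar r}"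

definition satisfies :: "('a, 'f) algebra \<Rightarrow> 'f identity \<Rightarrow> bool" where
  "satisfies A e \<longleftrightarrow>
     (\<forall>\<rho>. range \<rho> \<subseteq> carrier A \<longrightarrow> term_val A \<rho> (fst e) = term_val A \<rho> (snd e))"

(* A variety is given by its signature (arity function) ar and a set E of defining
   identities; being polymorphic in 'a, this predicate covers algebras on every type. *)
definition in_variety :: "('f \<Rightarrow> nat) \<Rightarrow> 'f identity set \<Rightarrow> ('a, 'f) algebra \<Rightarrow> bool" where
  "in_variety ar E A \<longleftrightarrow> is_algebra ar A \<and> (\<forall>e \<in> E. satisfies A e)"

(* HOL cannot quantify over the carrier types of the target algebras B inside a
   definition. The type of sets of terms over 'a is large enough to hold a copy of
   every algebra generated by an image of X, so the universal property below implies
   the one for targets on arbitrary types: see freely_generated_extend. *)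
definition freely_generated ::
  "('f \<Rightarrow> nat) \<Rightarrow> 'f identity set \<Rightarrow> ('a, 'f) algebra \<Rightarrow> 'a set \<Rightarrow> bool" where
  "freely_generated ar E F X \<longleftrightarrow>
     in_variety ar E F \<and> generates ar F X \<and>
     (\<forall>(B :: (('a, 'f) trm set, 'f) algebra) g.
        in_variety ar E B \<and> g \<in> X \<rightarrow> carrier B \<longrightarrow>
        (\<exists>h \<in> alg_hom ar F B. \<forall>x \<in> X. h x = g x))"

definition End_monoid :: "('f \<Rightarrow> nat) \<Rightarrow> ('a, 'f) algebra \<Rightarrow> ('a \<Rightarrow> 'a) monoid" where
  "End_monoid ar F =
     \<lparr>carrier = alg_hom ar F F, mult = compose (carrier F), one = (\<lambda>x \<in> carrier F. x)\<rparr>"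

definition Aut :: "('f \<Rightarrow> nat) \<Rightarrow> ('a, 'f) algebra \<Rightarrow> ('a \<Rightarrow> 'a) set" where
  "Aut ar F = {h \<in> alg_hom ar F F. bij_betw h (carrier F) (carrier F)}"

definition basis_perms :: "('f \<Rightarrow> nat) \<Rightarrow> ('a, 'f) algebra \<Rightarrow> 'a set \<Rightarrow> ('a \<Rightarrow> 'a) set" where
  "basis_perms ar F X = {\<gamma> \<in> Aut ar F. \<gamma> ` X = X}"

definition conjugate :: "'a set \<Rightarrow> ('a \<Rightarrow> 'a) \<Rightarrow> ('a \<Rightarrow> 'a) \<Rightarrow> 'a \<Rightarrow> 'a" where
  "conjugate S s \<nu> = compose S s (compose S \<nu> (inv_into S s))"

definition quasi_inner ::
  "('f \<Rightarrow> nat) \<Rightarrow> ('a, 'f) algebra \<Rightarrow> (('a \<Rightarrow> 'a) \<Rightarrow> ('a \<Rightarrow> 'a)) \<Rightarrow> bool" where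
  "quasi_inner ar F \<Phi> \<longleftrightarrow>
     (\<exists>s. bij_betw s (carrier F) (carrier F) \<and>
          (\<forall>\<nu> \<in> alg_hom ar F F. \<Phi> \<nu> = conjugate (carrier F) s \<nu>))"

definition inner_on ::
  "('f \<Rightarrow> nat) \<Rightarrow> ('a, 'f) algebra \<Rightarrow> ('a \<Rightarrow> 'a) set \<Rightarrow> (('a \<Rightarrow> 'a) \<Rightarrow> ('a \<Rightarrow> 'a)) \<Rightarrow> bool" where
  "inner_on ar F P \<Phi> \<longleftrightarrow>
     (\<exists>\<sigma> \<in> Aut ar F. \<forall>\<gamma> \<in> P. \<Phi> \<gamma> = conjugate (carrier F) \<sigma> \<gamma>)"

lemma term_val_closed:
  assumes "is_algebra ar A" "wf_trm ar t" "\<rho> ` vars t \<subseteq> carrier A"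
  shows "term_val A \<rho> t \<in> carrier A"
  using assms(2,3)
proof (induction t)
  case (App f ts)
  have "\<forall>t \<in> set ts. term_val A \<rho> t \<in> carrier A"
    using App by fastforce
  then have "set (map (term_val A \<rho>) ts) \<subseteq> carrier A" by auto
  then show ?case using assms(1) App.prems(1) by (auto simp: is_algebra_def)
qed auto

theorem freely_generated_extend:
  fixes F :: "('a, 'f) algebra" and B :: "('b, 'f) algebra"
  assumes E: "E \<subseteq> identities ar" and free: "freely_generated ar E F X"
    and B: "in_variety ar E B" and g: "g \<in> X \<rightarrow> carrier B"
  shows "\<exists>!h. h \<in> alg_hom ar F B \<and> (\<forall>x \<in> X. h x = g x)"
proof (rule ex_ex1I)
  define T where "T = {t :: ('a, 'f) trm. wf_trm ar t \<and> vars t \<subseteq> X}"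
  define S where "S = term_val B g ` T"
  define e where "e = (\<lambda>b. {t \<in> T. term_val B g t = b})"
  define d where "d = inv_into S e"
  define C where
    "C = \<lparr>carrier = e ` S, interp = \<lambda>f us. e (interp B f (map d us))\<rparr>"
  have Balg: "is_algebra ar B" using B by (simp add: in_variety_def)
  have SB: "S \<subseteq> carrier B"
  proof
    fix b assume "b \<in> S"
    then obtain t where t: "t \<in> T" "b = term_val B g t" by (auto simp: S_def)
    then show "b \<in> carrier B"
      using term_val_closed[OF Balg, of t g] g by (auto simp: T_def)
  qed
  have inj: "inj_on e S"
    by (rule inj_onI) (auto simp: e_def S_def)
  have de: "d (e b) = b" if "b \<in> S" for b
    using that inj by (simp add: d_def)
  have dS: "d u \<in> S" "e (d u) = u" if "u \<in> e ` S" for u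
    using that by (auto simp: d_def inv_into_into f_inv_into_f)
  have Sclosed: "interp B f bs \<in> S" if "length bs = ar f" "set bs \<subseteq> S" for f bs
  proof -
    have "\<forall>b \<in> set bs. \<exists>t. t \<in> T \<and> term_val B g t = b"
      using that by (auto simp: S_def)
    then obtain k where k: "\<forall>b \<in> set bs. k b \<in> T \<and> term_val B g (k b) = b" by metis
    have "App f (map k bs) \<in> T" using k that by (auto simp: T_def)
    moreover have "map (term_val B g \<circ> k) bs = bs"
      using k by (intro map_idI) auto
    then have "term_val B g (App f (map k bs)) = interp B f bs" by simp
    ultimately show ?thesis unfolding S_def by (metis image_eqI)
  qed
  have mapd: "set (map d us) \<subseteq> S" if "set us \<subseteq> e ` S" for us
    using that dS by auto
  have Calg: "is_algebra ar C"
    using Sclosed mapd by (auto simp: is_algebra_def C_def)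
  have dC: "d (term_val C \<rho> t) = term_val B (d \<circ> \<rho>) t"
    if "wf_trm ar t" "range \<rho> \<subseteq> carrier C" for t and \<rho> :: "nat \<Rightarrow> ('a, 'f) trm set"
    using that(1)
  proof (induction t)
    case (App f ts)
    have eq: "map (d \<circ> term_val C \<rho>) ts = map (term_val B (d \<circ> \<rho>)) ts"
      using App by (auto simp: comp_def)
    have "set (map (term_val C \<rho>) ts) \<subseteq> e ` S"
      using App.prems that(2) term_val_closed[OF Calg, of _ \<rho>]
      by (fastforce simp: C_def)
    then have "interp B f (map d (map (term_val C \<rho>) ts)) \<in> S"
      using App.prems by (intro Sclosed mapd) auto
    then have "d (interp C f (map (term_val C \<rho>) ts)) =
        interp B f (map d (map (term_val C \<rho>) ts))"
      using de by (simp only: C_def algebra.simps)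
    then show ?case by (simp only: term_val.simps map_map eq)
  qed simp
  have "satisfies C p" if p: "p \<in> E" for p
    unfolding satisfies_def
  proof (intro allI impI)
    fix \<rho> :: "nat \<Rightarrow> ('a, 'f) trm set" assume r: "range \<rho> \<subseteq> carrier C"
    have wf: "wf_trm ar (fst p)" "wf_trm ar (snd p)"
      using E p by (auto simp: identities_def)
    have "d u \<in> carrier B" if "u \<in> carrier C" for u
      using dS(1)[of u] SB that by (auto simp: C_def)
    then have "range (d \<circ> \<rho>) \<subseteq> carrier B" using r by (simp add: image_subset_iff)
    then have "term_val B (d \<circ> \<rho>) (fst p) = term_val B (d \<circ> \<rho>) (snd p)"
      using B p by (auto simp: in_variety_def satisfies_def)
    then have dd: "d (term_val C \<rho> (fst p)) = d (term_val C \<rho> (snd p))"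
      using dC[OF wf(1) r] dC[OF wf(2) r] by simp
    have cC: "\<rho> ` vars t \<subseteq> carrier C" for t :: "(nat, 'f) trm"
      using r by blast
    have "term_val C \<rho> (fst p) \<in> carrier C" "term_val C \<rho> (snd p) \<in> carrier C"
      by (rule term_val_closed[OF Calg wf(1) cC], rule term_val_closed[OF Calg wf(2) cC])
    then have "e (d (term_val C \<rho> (fst p))) = term_val C \<rho> (fst p)"
      "e (d (term_val C \<rho> (snd p))) = term_val C \<rho> (snd p)"
      using dS(2) by (simp_all only: C_def partial_object.simps)
    then show "term_val C \<rho> (fst p) = term_val C \<rho> (snd p)"
      using dd by metis
  qed
  then have CV: "in_variety ar E C" using Calg by (simp add: in_variety_def)
  have gS: "g x \<in> S" if "x \<in> X" for x
    using that unfolding S_def by (intro image_eqI[of _ _ "Var x"]) (auto simp: T_def)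
  then have "(\<lambda>x. e (g x)) \<in> X \<rightarrow> carrier C" by (auto simp: C_def)
  then obtain h where h: "h \<in> alg_hom ar F C" "\<forall>x \<in> X. h x = e (g x)"
    using free CV unfolding freely_generated_def by meson
  have hC: "h a \<in> e ` S" if "a \<in> carrier F" for a
    using h(1) that by (auto simp: alg_hom_def C_def)
  have Falg: "is_algebra ar F" and XF: "X \<subseteq> carrier F"
    using free by (auto simp: freely_generated_def in_variety_def generates_def)
  define k where "k = (\<lambda>a \<in> carrier F. d (h a))"
  have "k (interp F f as) = interp B f (map k as)"
    if "length as = ar f" "set as \<subseteq> carrier F" for f as
  proof -
    have "interp F f as \<in> carrier F" using Falg that by (auto simp: is_algebra_def)
    then have "k (interp F f as) = d (interp C f (map h as))"
      using h(1) that by (auto simp: alg_hom_def k_def)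
    also have "\<dots> = d (e (interp B f (map d (map h as))))" by (simp add: C_def)
    also have "\<dots> = interp B f (map d (map h as))"
      using that hC by (intro de Sclosed mapd) auto
    also have "map d (map h as) = map k as" using that by (auto simp: k_def)
    finally show ?thesis .
  qed
  moreover have "k \<in> carrier F \<rightarrow>\<^sub>E carrier B"
    using hC dS SB by (auto simp: k_def)
  moreover have "\<forall>x \<in> X. k x = g x"
    using h(2) XF gS de by (auto simp: k_def)
  ultimately show "\<exists>h. h \<in> alg_hom ar F B \<and> (\<forall>x \<in> X. h x = g x)"
    by (auto simp: alg_hom_def)
next
  fix h k
  assume h: "h \<in> alg_hom ar F B \<and> (\<forall>x \<in> X. h x = g x)"
    and k: "k \<in> alg_hom ar F B \<and> (\<forall>x \<in> X. k x = g x)"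
  define S where "S = {a \<in> carrier F. h a = k a}"
  have Falg: "is_algebra ar F" and gen: "generates ar F X"
    using free by (auto simp: freely_generated_def in_variety_def)
  have "interp F f as \<in> S" if "length as = ar f" "set as \<subseteq> S" for f as
  proof -
    have sub: "set as \<subseteq> carrier F" using that by (auto simp: S_def)
    have "map h as = map k as" using that by (auto simp: S_def)
    moreover have "h (interp F f as) = interp B f (map h as)"
      "k (interp F f as) = interp B f (map k as)"
      using h k that(1) sub by (simp_all add: alg_hom_def)
    ultimately have "h (interp F f as) = k (interp F f as)" by metis
    then show ?thesis using Falg that(1) sub by (auto simp: is_algebra_def S_def)
  qed
  then have "subuniverse ar F S" by (auto simp: subuniverse_def S_def)
  moreover have "X \<subseteq> S" using h k gen by (auto simp: S_def generates_def)
  ultimately have "S = carrier F" using gen by (auto simp: generates_def)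
  then show "h = k"
    using h k by (intro extensionalityI[of _ "carrier F"]) (auto simp: alg_hom_def S_def PiE_def)
qed

end

theory Submission
  imports Defs "HOL-Combinatorics.Permutations"
begin

text \<open>
  The three conditions are proved in a cycle, 1 to 2 to 3 to 1.

  The steps from 1 to 2 and from 3 to 1 rest on one consequence of freeness: every map from
  the basis into \<open>F\<close> extends to exactly one endomorphism of \<open>F\<close> (\<open>End_basis\<close>). This
  speaks only of \<open>End(F)\<close> and its action on \<open>F\<close>, so an automorphism of \<open>End(F)\<close> can transport it.

  From 1 to 2: if \<open>\<Phi>\<close> is conjugation by a bijection \<open>s\<close>, then \<open>s(X)\<close> inherits this unique
  extension property from \<open>X\<close>, although \<open>s\<close> need not be a homomorphism
  (\<open>End_basis_conjugate\<close>). The homomorphism \<open>\<sigma>\<close> that agrees with \<open>s\<close> on \<open>X\<close> is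
  therefore an automorphism (\<open>bij_extends_to_Aut\<close>). For \<open>\<gamma>\<close> permuting \<open>X\<close>, the endomorphisms
  \<open>\<Phi>(\<gamma>)\<close> and \<open>\<sigma> \<circ> \<gamma> \<circ> \<sigma>\<^sup>-\<^sup>1\<close> agree on \<open>s(X)\<close>, hence everywhere.

  From 2 to 3: the automorphism \<open>\<sigma>\<close> carries the basis \<open>X\<close> to a basis \<open>\<sigma>(X)\<close>, which
  \<open>\<sigma> \<circ> \<gamma> \<circ> \<sigma>\<^sup>-\<^sup>1\<close> permutes whenever \<open>\<gamma>\<close> permutes \<open>X\<close>.

  From 3 to 1: an element \<open>a\<close> of \<open>F\<close> is encoded by the endomorphism \<open>c\<^sub>a\<close> that sends all of \<open>X\<close>
  to \<open>a\<close> (for \<open>n > 0\<close>; if \<open>n = 0\<close>, the identity is the only endomorphism). Since \<open>P\<close> is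
  transitive on \<open>X\<close>, these are exactly the \<open>\<nu>\<close> with \<open>\<nu> \<circ> \<gamma> = \<nu>\<close> for all
  \<open>\<gamma> \<in> P\<close>. Both \<open>P\<close> and the group of automorphisms permuting \<open>Y\<close> have order \<open>n!\<close>
  (\<open>card_basis_perms\<close>), so \<open>\<Phi>\<close> maps the former onto the latter. Thus \<open>\<Phi>\<close> maps
  the endomorphisms constant on \<open>X\<close> bijectively to those constant on \<open>Y\<close>, and so induces a
  bijection \<open>s\<close> of \<open>F\<close>. From \<open>\<nu> \<circ> c\<^sub>a = c\<^bsub>\<nu>(a)\<^esub>\<close> it follows that \<open>\<Phi>(\<nu>)(s(a)) = s(\<nu>(a))\<close>.
\<close>

section \<open>Homomorphisms and conjugation\<close>

lemma alg_hom_apply: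
  assumes "h \<in> alg_hom ar A B" "a \<in> carrier A"
  shows "h a \<in> carrier B"
  using assms by (auto simp: alg_hom_def)

lemma alg_hom_extensional: "h \<in> alg_hom ar A B \<Longrightarrow> h \<in> extensional (carrier A)"
  by (auto simp: alg_hom_def PiE_def)

lemma alg_hom_compose:
  assumes A: "is_algebra ar A" and h: "h \<in> alg_hom ar A B" and k: "k \<in> alg_hom ar B C"
  shows "compose (carrier A) k h \<in> alg_hom ar A C"
proof -
  have "compose (carrier A) k h (interp A f as) = interp C f (map (compose (carrier A) k h) as)"
    if as: "length as = ar f" "set as \<subseteq> carrier A" for f as
  proof -
    have "interp A f as \<in> carrier A" using A as by (auto simp: is_algebra_def)
    moreover have "h (interp A f as) = interp B f (map h as)"
      using h as by (auto simp: alg_hom_def)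
    moreover have "set (map h as) \<subseteq> carrier B" using as alg_hom_apply[OF h] by auto
    then have "k (interp B f (map h as)) = interp C f (map k (map h as))"
      using k as by (auto simp: alg_hom_def)
    moreover have "map k (map h as) = map (compose (carrier A) k h) as"
      using as by (auto simp: compose_eq)
    ultimately show ?thesis by (simp only: compose_eq)
  qed
  moreover have "compose (carrier A) k h \<in> carrier A \<rightarrow>\<^sub>E carrier C"
    using alg_hom_apply[OF h] alg_hom_apply[OF k] by (auto simp: compose_def)
  ultimately show ?thesis by (simp add: alg_hom_def)
qed

lemma alg_hom_inv_into:
  assumes A: "is_algebra ar A" and h: "h \<in> alg_hom ar A B"
    and bij: "bij_betw h (carrier A) (carrier B)"
  shows "restrict (inv_into (carrier A) h) (carrier B) \<in> alg_hom ar B A"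
proof -
  let ?k = "restrict (inv_into (carrier A) h) (carrier B)"
  have k: "?k b \<in> carrier A" "h (?k b) = b" if "b \<in> carrier B" for b
    using that bij by (auto simp: bij_betw_def inv_into_into f_inv_into_f)
  have "?k (interp B f bs) = interp A f (map ?k bs)"
    if bs: "length bs = ar f" "set bs \<subseteq> carrier B" for f bs
  proof -
    have sub: "set (map ?k bs) \<subseteq> carrier A" using k bs by auto
    have mem: "interp A f (map ?k bs) \<in> carrier A"
      using A bs(1) sub by (auto simp: is_algebra_def)
    have "h (interp A f (map ?k bs)) = interp B f (map h (map ?k bs))"
      using h bs(1) sub by (simp add: alg_hom_def)
    also have "map h (map ?k bs) = bs"
      unfolding map_map using k(2) bs(2) by (intro map_idI) (auto simp del: restrict_apply)
    finally have eq: "h (interp A f (map ?k bs)) = interp B f bs" .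
    then have "interp B f bs \<in> carrier B" using alg_hom_apply[OF h mem] by simp
    then have "h (?k (interp B f bs)) = h (interp A f (map ?k bs))" using k(2) eq by simp
    then show ?thesis
      using bij k(1) \<open>interp B f bs \<in> carrier B\<close> mem by (auto simp: bij_betw_def inj_on_def)
  qed
  moreover have "?k \<in> carrier B \<rightarrow>\<^sub>E carrier A" using k(1) by auto
  ultimately show ?thesis by (simp only: alg_hom_def mem_Collect_eq) blast
qed

lemma conjugate_apply:
  assumes "bij_betw s S S" "a \<in> S" "\<nu> a \<in> S"
  shows "conjugate S s \<nu> (s a) = s (\<nu> a)"
  using assms by (auto simp: conjugate_def compose_def bij_betw_def)

lemma conjugate_eqI:
  assumes "bij_betw s S S" "f \<in> extensional S" "\<nu> \<in> S \<rightarrow> S"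
    and "\<And>a. a \<in> S \<Longrightarrow> f (s a) = s (\<nu> a)"
  shows "f = conjugate S s \<nu>"
proof (rule extensionalityI[of _ S])
  fix b assume "b \<in> S"
  then obtain a where "a \<in> S" "b = s a" using assms(1) by (auto simp: bij_betw_def)
  then show "f b = conjugate S s \<nu> b"
    using assms by (metis conjugate_apply funcset_mem)
qed (use assms in \<open>auto simp: conjugate_def\<close>)

section \<open>Sets with unique extension to endomorphisms\<close>

text \<open>
  This is freeness tested against the algebra \<open>F\<close> alone. Stated in this form, it can be
  carried along a conjugation of \<open>End(F)\<close> by a bijection that is not a homomorphism.
\<close>

definition End_basis :: "('f \<Rightarrow> nat) \<Rightarrow> ('a, 'f) algebra \<Rightarrow> 'a set \<Rightarrow> bool" where
  "End_basis ar F X \<longleftrightarrow> X \<subseteq> carrier F \<and>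
     (\<forall>g \<in> X \<rightarrow> carrier F. \<exists>!h. h \<in> alg_hom ar F F \<and> (\<forall>x \<in> X. h x = g x))"

lemma freely_generated_End_basis:
  assumes "E \<subseteq> identities ar" "freely_generated ar E F X"
  shows "End_basis ar F X"
  unfolding End_basis_def
proof (intro conjI ballI)
  show "X \<subseteq> carrier F" using assms(2) by (simp add: freely_generated_def generates_def)
  have "in_variety ar E F" using assms(2) by (simp add: freely_generated_def)
  then show "\<exists>!h. h \<in> alg_hom ar F F \<and> (\<forall>x \<in> X. h x = g x)"
    if "g \<in> X \<rightarrow> carrier F" for g
    using freely_generated_extend[OF assms _ that] by blast
qed

lemma End_basis_extend:
  assumes "End_basis ar F X" "g \<in> X \<rightarrow> carrier F"
  obtains h where "h \<in> alg_hom ar F F" "\<And>x. x \<in> X \<Longrightarrow> h x = g x"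
  using assms unfolding End_basis_def by blast

lemma End_basis_eqI:
  assumes X: "End_basis ar F X" and h: "h \<in> alg_hom ar F F" and k: "k \<in> alg_hom ar F F"
    and eq: "\<And>x. x \<in> X \<Longrightarrow> h x = k x"
  shows "h = k"
proof -
  have "k \<in> X \<rightarrow> carrier F" using X alg_hom_apply[OF k] by (auto simp: End_basis_def)
  then have "\<exists>!h. h \<in> alg_hom ar F F \<and> (\<forall>x \<in> X. h x = k x)"
    using X unfolding End_basis_def by blast
  then show ?thesis using h k eq by blast
qed

text \<open>
  The extensions of \<open>p\<close> and of its inverse compose to endomorphisms fixing \<open>X\<close> and \<open>Y\<close>
  pointwise, respectively; by uniqueness of extensions both composites are the identity.
\<close>

lemma bij_extends_to_Aut:
  assumes F: "is_algebra ar F" and X: "End_basis ar F X" and Y: "End_basis ar F Y"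
    and p: "bij_betw p X Y"
  obtains \<sigma> where "\<sigma> \<in> Aut ar F" "\<And>x. x \<in> X \<Longrightarrow> \<sigma> x = p x"
proof -
  have sub: "X \<subseteq> carrier F" "Y \<subseteq> carrier F" using X Y by (auto simp: End_basis_def)
  have pX: "p x \<in> Y" "inv_into X p (p x) = x" if "x \<in> X" for x
    using that p by (auto simp: bij_betw_def)
  have pY: "inv_into X p y \<in> X" "p (inv_into X p y) = y" if "y \<in> Y" for y
    using that p by (auto simp: bij_betw_def inv_into_into f_inv_into_f)
  obtain \<sigma> where \<sigma>: "\<sigma> \<in> alg_hom ar F F" "\<And>x. x \<in> X \<Longrightarrow> \<sigma> x = p x"
    using End_basis_extend[OF X, of p] pX sub by blast
  obtain \<tau> where \<tau>: "\<tau> \<in> alg_hom ar F F" "\<And>y. y \<in> Y \<Longrightarrow> \<tau> y = inv_into X p y"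
    using End_basis_extend[OF Y, of "inv_into X p"] pY sub by blast
  have id: "(\<lambda>a \<in> carrier F. a) \<in> alg_hom ar F F"
    using F by (auto simp: alg_hom_def is_algebra_def intro!: arg_cong[of _ _ "interp F _"]
        map_idI[symmetric])
  have "compose (carrier F) \<tau> \<sigma> = (\<lambda>a \<in> carrier F. a)"
    by (rule End_basis_eqI[OF X alg_hom_compose[OF F \<sigma>(1) \<tau>(1)] id])
      (use \<sigma> \<tau> pX sub in \<open>auto simp: compose_def\<close>)
  then have l: "\<tau> (\<sigma> a) = a" if "a \<in> carrier F" for a
    using that by (metis compose_eq restrict_apply')
  have "compose (carrier F) \<sigma> \<tau> = (\<lambda>a \<in> carrier F. a)"
    by (rule End_basis_eqI[OF Y alg_hom_compose[OF F \<tau>(1) \<sigma>(1)] id])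
      (use \<sigma> \<tau> pY sub in \<open>auto simp: compose_def\<close>)
  then have r: "\<sigma> (\<tau> a) = a" if "a \<in> carrier F" for a
    using that by (metis compose_eq restrict_apply')
  have "bij_betw \<sigma> (carrier F) (carrier F)"
    by (rule bij_betw_byWitness[where f' = \<tau>])
      (use l r alg_hom_apply[OF \<sigma>(1)] alg_hom_apply[OF \<tau>(1)] in auto)
  then show thesis using \<sigma> that by (auto simp: Aut_def)
qed

lemma permutation_extends:
  assumes F: "is_algebra ar F" and X: "End_basis ar F X" and p: "p permutes X"
  obtains \<gamma> where "\<gamma> \<in> basis_perms ar F X" "\<And>x. x \<in> X \<Longrightarrow> \<gamma> x = p x"
proof -
  obtain \<gamma> where \<gamma>: "\<gamma> \<in> Aut ar F" "\<And>x. x \<in> X \<Longrightarrow> \<gamma> x = p x"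
    using bij_extends_to_Aut[OF F X X permutes_imp_bij[OF p]] by blast
  then have "\<gamma> ` X = X" using permutes_image[OF p] by simp
  then show thesis using \<gamma> that by (auto simp: basis_perms_def)
qed

lemma card_basis_perms:
  assumes F: "is_algebra ar F" and X: "End_basis ar F X" and fin: "finite X"
  shows "card (basis_perms ar F X) = fact (card X)"
proof -
  let ?r = "\<lambda>\<gamma> x. if x \<in> X then \<gamma> x else x"
  have sub: "X \<subseteq> carrier F" using X by (simp add: End_basis_def)
  have "bij_betw ?r (basis_perms ar F X) {p. p permutes X}"
  proof (rule bij_betw_imageI)
    show "inj_on ?r (basis_perms ar F X)"
    proof (rule inj_onI)
      fix \<gamma> \<delta> assume *: "\<gamma> \<in> basis_perms ar F X" "\<delta> \<in> basis_perms ar F X" "?r \<gamma> = ?r \<delta>"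
      have "\<gamma> x = \<delta> x" if "x \<in> X" for x using fun_cong[OF *(3), of x] that by simp
      then show "\<gamma> = \<delta>" using * by (intro End_basis_eqI[OF X]) (auto simp: basis_perms_def Aut_def)
    qed
    have "?r \<gamma> permutes X" if "\<gamma> \<in> basis_perms ar F X" for \<gamma>
    proof (rule bij_imp_permutes)
      have "inj_on \<gamma> X" "\<gamma> ` X = X"
        using that sub by (auto simp: basis_perms_def Aut_def bij_betw_def intro: inj_on_subset)
      then show "bij_betw (?r \<gamma>) X X" by (simp add: bij_betw_def cong: inj_on_cong)
    qed simp
    moreover have "p \<in> ?r ` basis_perms ar F X" if p: "p permutes X" for p
    proof -
      obtain \<gamma> where "\<gamma> \<in> basis_perms ar F X" "\<And>x. x \<in> X \<Longrightarrow> \<gamma> x = p x"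
        using permutation_extends[OF F X p] by blast
      moreover from this have "?r \<gamma> = p" using p by (auto simp: permutes_not_in)
      ultimately show ?thesis by blast
    qed
    ultimately show "?r ` basis_perms ar F X = {p. p permutes X}" by auto
  qed
  then show ?thesis using card_permutations[OF refl fin] by (simp add: bij_betw_same_card)
qed

text \<open>
  Invariance under the basis permutations, a condition in the semigroup \<open>End(F)\<close>, detects
  the endomorphisms that are constant on the basis, because transpositions make the
  permutations transitive.
\<close>

lemma basis_perms_invariant_iff_constant:
  assumes F: "is_algebra ar F" and X: "End_basis ar F X" and \<nu>: "\<nu> \<in> alg_hom ar F F"
  shows "(\<forall>\<gamma> \<in> basis_perms ar F X. compose (carrier F) \<nu> \<gamma> = \<nu>) \<longleftrightarrow>
    (\<forall>x \<in> X. \<forall>y \<in> X. \<nu> x = \<nu> y)"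
proof
  assume inv: "\<forall>\<gamma> \<in> basis_perms ar F X. compose (carrier F) \<nu> \<gamma> = \<nu>"
  show "\<forall>x \<in> X. \<forall>y \<in> X. \<nu> x = \<nu> y"
  proof (intro ballI)
    fix x y assume xy: "x \<in> X" "y \<in> X"
    obtain \<gamma> where "\<gamma> \<in> basis_perms ar F X" "\<And>z. z \<in> X \<Longrightarrow> \<gamma> z = transpose x y z"
      using permutation_extends[OF F X permutes_swap_id[OF xy]] by blast
    then have "compose (carrier F) \<nu> \<gamma> = \<nu>" "\<gamma> x = y" using inv xy by auto
    then show "\<nu> x = \<nu> y"
      using xy X by (metis End_basis_def compose_eq subsetD)
  qed
next
  assume const: "\<forall>x \<in> X. \<forall>y \<in> X. \<nu> x = \<nu> y"
  show "\<forall>\<gamma> \<in> basis_perms ar F X. compose (carrier F) \<nu> \<gamma> = \<nu>"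
  proof
    fix \<gamma> assume \<gamma>: "\<gamma> \<in> basis_perms ar F X"
    then have hom: "\<gamma> \<in> alg_hom ar F F" by (simp add: basis_perms_def Aut_def)
    show "compose (carrier F) \<nu> \<gamma> = \<nu>"
    proof (rule End_basis_eqI[OF X alg_hom_compose[OF F hom \<nu>] \<nu>])
      fix x assume x: "x \<in> X"
      then have "\<gamma> x \<in> X" "x \<in> carrier F" using \<gamma> X by (auto simp: basis_perms_def End_basis_def)
      moreover from this have "\<nu> (\<gamma> x) = \<nu> x" using const x by blast
      ultimately show "compose (carrier F) \<nu> \<gamma> x = \<nu> x" by (simp add: compose_eq)
    qed
  qed
qed

section \<open>Automorphisms of the endomorphism monoid\<close>

lemma End_iso_bij:
  "\<Phi> \<in> iso (End_monoid ar F) (End_monoid ar F) \<Longrightarrow>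
    bij_betw \<Phi> (alg_hom ar F F) (alg_hom ar F F)"
  by (simp add: iso_def End_monoid_def)

lemma End_iso_compose:
  assumes "\<Phi> \<in> iso (End_monoid ar F) (End_monoid ar F)"
    and "\<mu> \<in> alg_hom ar F F" "\<nu> \<in> alg_hom ar F F"
  shows "\<Phi> (compose (carrier F) \<mu> \<nu>) = compose (carrier F) (\<Phi> \<mu>) (\<Phi> \<nu>)"
  using assms by (simp add: iso_def hom_def End_monoid_def)

lemma End_iso_closed:
  assumes "\<Phi> \<in> iso (End_monoid ar F) (End_monoid ar F)" "\<nu> \<in> alg_hom ar F F"
  shows "\<Phi> \<nu> \<in> alg_hom ar F F"
  using End_iso_bij[OF assms(1)] assms(2) by (auto simp: bij_betw_def)

text \<open>
  An extension of \<open>g\<close> from \<open>s(X)\<close> is obtained by extending \<open>s\<^sup>-\<^sup>1 \<circ> g \<circ> s\<close> from \<open>X\<close> to \<open>\<nu>\<close>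
  and taking \<open>s \<circ> \<nu> \<circ> s\<^sup>-\<^sup>1\<close>, an endomorphism because it is \<open>\<Phi>(\<nu>)\<close>. Uniqueness
  holds because every endomorphism is some \<open>\<Phi>(\<nu>)\<close>.
\<close>

lemma End_basis_conjugate:
  assumes \<Phi>: "bij_betw \<Phi> (alg_hom ar F F) (alg_hom ar F F)"
    and s: "bij_betw s (carrier F) (carrier F)"
    and conj: "\<And>\<nu>. \<nu> \<in> alg_hom ar F F \<Longrightarrow> \<Phi> \<nu> = conjugate (carrier F) s \<nu>"
    and X: "End_basis ar F X"
  shows "End_basis ar F (s ` X)"
  unfolding End_basis_def
proof (intro conjI ballI)
  have sub: "X \<subseteq> carrier F" using X by (simp add: End_basis_def)
  then show "s ` X \<subseteq> carrier F" using s by (auto simp: bij_betw_def)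
  have app: "\<Phi> \<nu> (s a) = s (\<nu> a)" if "\<nu> \<in> alg_hom ar F F" "a \<in> carrier F" for \<nu> a
    using that conj conjugate_apply[OF s] alg_hom_apply by metis
  fix g assume g: "g \<in> s ` X \<rightarrow> carrier F"
  have sinv: "inv_into (carrier F) s b \<in> carrier F" "s (inv_into (carrier F) s b) = b"
    if "b \<in> carrier F" for b
    using that s by (auto simp: bij_betw_def inv_into_into f_inv_into_f)
  show "\<exists>!h. h \<in> alg_hom ar F F \<and> (\<forall>x \<in> s ` X. h x = g x)"
  proof (rule ex_ex1I)
    have "(\<lambda>x. inv_into (carrier F) s (g (s x))) \<in> X \<rightarrow> carrier F"
      using g sinv(1) by blast
    then obtain \<nu> where \<nu>: "\<nu> \<in> alg_hom ar F F"
      "\<And>x. x \<in> X \<Longrightarrow> \<nu> x = inv_into (carrier F) s (g (s x))"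
      using End_basis_extend[OF X] by blast
    have "\<Phi> \<nu> \<in> alg_hom ar F F" using \<Phi> \<nu>(1) by (auto simp: bij_betw_def)
    moreover have "\<Phi> \<nu> (s x) = g (s x)" if "x \<in> X" for x
    proof -
      have "x \<in> carrier F" "g (s x) \<in> carrier F" using that sub g by auto
      then show ?thesis using app[OF \<nu>(1)] \<nu>(2)[OF that] sinv(2) by simp
    qed
    ultimately show "\<exists>h. h \<in> alg_hom ar F F \<and> (\<forall>x \<in> s ` X. h x = g x)" by blast
  next
    fix h k
    assume h: "h \<in> alg_hom ar F F \<and> (\<forall>x \<in> s ` X. h x = g x)"
      and k: "k \<in> alg_hom ar F F \<and> (\<forall>x \<in> s ` X. k x = g x)"
    obtain \<mu> \<nu> where mn: "\<mu> \<in> alg_hom ar F F" "h = \<Phi> \<mu>" "\<nu> \<in> alg_hom ar F F" "k = \<Phi> \<nu>"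
      using h k \<Phi> unfolding bij_betw_def by (metis imageE)
    have "\<mu> x = \<nu> x" if x: "x \<in> X" for x
    proof -
      have xF: "x \<in> carrier F" using x sub by blast
      have "h (s x) = k (s x)" using h k x by auto
      then have "s (\<mu> x) = s (\<nu> x)" using app mn xF by simp
      then show ?thesis
        using s alg_hom_apply[OF mn(1) xF] alg_hom_apply[OF mn(3) xF]
        by (auto simp: bij_betw_def inj_on_def)
    qed
    then show "h = k" using End_basis_eqI[OF X mn(1,3)] mn by simp
  qed
qed

lemma quasi_inner_imp_inner_on_basis_perms:
  assumes F: "is_algebra ar F" and X: "End_basis ar F X"
    and \<Phi>: "\<Phi> \<in> iso (End_monoid ar F) (End_monoid ar F)" and qi: "quasi_inner ar F \<Phi>"
  shows "inner_on ar F (basis_perms ar F X) \<Phi>"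
proof -
  obtain s where s: "bij_betw s (carrier F) (carrier F)"
    and conj: "\<And>\<nu>. \<nu> \<in> alg_hom ar F F \<Longrightarrow> \<Phi> \<nu> = conjugate (carrier F) s \<nu>"
    using qi unfolding quasi_inner_def by blast
  have sub: "X \<subseteq> carrier F" using X by (simp add: End_basis_def)
  have Y: "End_basis ar F (s ` X)"
    by (rule End_basis_conjugate[OF End_iso_bij[OF \<Phi>] s conj X])
  have "bij_betw s X (s ` X)"
    using s sub by (auto simp: bij_betw_def intro: inj_on_subset)
  then obtain \<sigma> where \<sigma>: "\<sigma> \<in> Aut ar F" "\<And>x. x \<in> X \<Longrightarrow> \<sigma> x = s x"
    using bij_extends_to_Aut[OF F X Y] by blast
  then have hom: "\<sigma> \<in> alg_hom ar F F" and bij: "bij_betw \<sigma> (carrier F) (carrier F)"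
    by (auto simp: Aut_def)
  have "\<Phi> \<gamma> = conjugate (carrier F) \<sigma> \<gamma>" if \<gamma>: "\<gamma> \<in> basis_perms ar F X" for \<gamma>
  proof -
    have \<gamma>X: "\<gamma> x \<in> X" if "x \<in> X" for x
      using \<gamma> that by (auto simp: basis_perms_def)
    have \<gamma>hom: "\<gamma> \<in> alg_hom ar F F" using \<gamma> by (auto simp: basis_perms_def Aut_def)
    note \<Phi>\<gamma> = End_iso_closed[OF \<Phi> \<gamma>hom]
    \<comment> \<open>Comparing after composition with \<open>\<sigma>\<close> moves the test from \<open>s(X)\<close> to \<open>X\<close>.\<close>
    have "compose (carrier F) (\<Phi> \<gamma>) \<sigma> = compose (carrier F) \<sigma> \<gamma>"
    proof (rule End_basis_eqI[OF X alg_hom_compose[OF F hom \<Phi>\<gamma>] alg_hom_compose[OF F \<gamma>hom hom]])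
      fix x assume x: "x \<in> X"
      then have xF: "x \<in> carrier F" using sub by blast
      have "\<Phi> \<gamma> (\<sigma> x) = \<Phi> \<gamma> (s x)" using \<sigma>(2) x by simp
      also have "\<dots> = s (\<gamma> x)"
        using conj[OF \<gamma>hom] conjugate_apply[OF s xF] alg_hom_apply[OF \<gamma>hom xF] by simp
      also have "\<dots> = \<sigma> (\<gamma> x)" using \<sigma>(2) \<gamma>X[OF x] by simp
      finally show "compose (carrier F) (\<Phi> \<gamma>) \<sigma> x = compose (carrier F) \<sigma> \<gamma> x"
        using xF by (simp add: compose_eq)
    qed
    then have "\<Phi> \<gamma> (\<sigma> a) = \<sigma> (\<gamma> a)" if "a \<in> carrier F" for a
      using that by (metis compose_eq)
    then show ?thesis
      using alg_hom_apply[OF \<gamma>hom]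
      by (intro conjugate_eqI[OF bij alg_hom_extensional[OF \<Phi>\<gamma>]]) auto
  qed
  then show ?thesis using \<sigma>(1) unfolding inner_on_def by blast
qed

lemma freely_generated_Aut_image:
  fixes F :: "('a, 'f) algebra"
  assumes free: "freely_generated ar E F X" and \<sigma>: "\<sigma> \<in> Aut ar F"
  shows "freely_generated ar E F (\<sigma> ` X)"
proof -
  have V: "in_variety ar E F" and F: "is_algebra ar F" and gen: "generates ar F X"
    using free by (auto simp: freely_generated_def in_variety_def)
  have sub: "X \<subseteq> carrier F" using gen by (simp add: generates_def)
  have hom: "\<sigma> \<in> alg_hom ar F F" and bij: "bij_betw \<sigma> (carrier F) (carrier F)"
    using \<sigma> by (auto simp: Aut_def)
  define \<tau> where "\<tau> = restrict (inv_into (carrier F) \<sigma>) (carrier F)"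
  have \<tau>: "\<tau> \<in> alg_hom ar F F" unfolding \<tau>_def by (rule alg_hom_inv_into[OF F hom bij])
  have \<tau>\<sigma>: "\<tau> (\<sigma> a) = a" if "a \<in> carrier F" for a
    using that bij alg_hom_apply[OF hom that] by (auto simp: \<tau>_def bij_betw_def)
  have \<sigma>\<tau>: "\<sigma> (\<tau> a) = a" if "a \<in> carrier F" for a
    using that bij by (auto simp: \<tau>_def bij_betw_def f_inv_into_f)
  have "generates ar F (\<sigma> ` X)"
    unfolding generates_def
  proof (intro conjI allI impI)
    show "\<sigma> ` X \<subseteq> carrier F" using sub alg_hom_apply[OF hom] by blast
    fix S assume S: "subuniverse ar F S \<and> \<sigma> ` X \<subseteq> S"
    define T where "T = {a \<in> carrier F. \<sigma> a \<in> S}"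
    have "interp F f as \<in> T" if as: "length as = ar f" "set as \<subseteq> T" for f as
    proof -
      have asF: "set as \<subseteq> carrier F" using as by (auto simp: T_def)
      then have "interp F f as \<in> carrier F" using F as by (auto simp: is_algebra_def)
      moreover have "\<sigma> (interp F f as) = interp F f (map \<sigma> as)"
        using hom as(1) asF by (simp add: alg_hom_def)
      moreover have "set (map \<sigma> as) \<subseteq> S" using as by (auto simp: T_def)
      then have "interp F f (map \<sigma> as) \<in> S" using S as(1) by (simp add: subuniverse_def)
      ultimately show ?thesis by (simp add: T_def)
    qed
    then have "subuniverse ar F T" by (auto simp: subuniverse_def T_def)
    moreover have "X \<subseteq> T" using S sub by (auto simp: T_def)
    ultimately have "T = carrier F" using gen by (simp add: generates_def)
    then have "b \<in> S" if "b \<in> carrier F" for b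
      using \<sigma>\<tau>[OF that] alg_hom_apply[OF \<tau> that] unfolding T_def by force
    then show "S = carrier F" using S by (auto simp: subuniverse_def)
  qed
  moreover have "\<exists>h \<in> alg_hom ar F B. \<forall>x \<in> \<sigma> ` X. h x = g x"
    if B: "in_variety ar E B" and g: "g \<in> \<sigma> ` X \<rightarrow> carrier B"
    for B :: "(('a, 'f) trm set, 'f) algebra" and g
  proof -
    have "(\<lambda>x. g (\<sigma> x)) \<in> X \<rightarrow> carrier B" using g by auto
    then obtain h where h: "h \<in> alg_hom ar F B" "\<forall>x \<in> X. h x = g (\<sigma> x)"
      using free B unfolding freely_generated_def by meson
    have "compose (carrier F) h \<tau> (\<sigma> x) = g (\<sigma> x)" if "x \<in> X" for x
      using that sub h(2) \<tau>\<sigma> alg_hom_apply[OF hom] by (auto simp: compose_def)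
    then show ?thesis using alg_hom_compose[OF F \<tau> h(1)] by blast
  qed
  ultimately show ?thesis using V unfolding freely_generated_def by blast
qed

lemma conjugate_basis_perm_preserves_image:
  assumes X: "End_basis ar F X" and \<sigma>: "\<sigma> \<in> Aut ar F" and \<gamma>: "\<gamma> \<in> basis_perms ar F X"
  shows "conjugate (carrier F) \<sigma> \<gamma> ` (\<sigma> ` X) = \<sigma> ` X"
proof -
  have sub: "X \<subseteq> carrier F" using X by (simp add: End_basis_def)
  have bij: "bij_betw \<sigma> (carrier F) (carrier F)" using \<sigma> by (simp add: Aut_def)
  have \<gamma>X: "\<gamma> ` X = X" using \<gamma> by (simp add: basis_perms_def)
  have "conjugate (carrier F) \<sigma> \<gamma> (\<sigma> x) = \<sigma> (\<gamma> x)" if "x \<in> X" for x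
    using that sub \<gamma>X by (intro conjugate_apply[OF bij]) auto
  then have "conjugate (carrier F) \<sigma> \<gamma> ` (\<sigma> ` X) = \<sigma> ` (\<gamma> ` X)"
    unfolding image_image by (intro image_cong) auto
  then show ?thesis by (simp only: \<gamma>X)
qed

section \<open>Recovering a bijection from the preserved basis\<close>

text \<open>
  Preservation of \<open>Y\<close> gives only an injection into the group of permutations of \<open>Y\<close>, whose image
  might fail to be transitive. Counting shows that the image is the whole group.
\<close>

lemma End_iso_maps_basis_perms_onto:
  assumes F: "is_algebra ar F" and X: "End_basis ar F X" and Y: "End_basis ar F Y"
    and fin: "finite X" "finite Y" and card: "card X = card Y"
    and \<Phi>: "\<Phi> \<in> iso (End_monoid ar F) (End_monoid ar F)"
    and pres: "\<And>\<gamma>. \<gamma> \<in> basis_perms ar F X \<Longrightarrow> \<Phi> \<gamma> ` Y = Y"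
  shows "\<Phi> ` basis_perms ar F X = basis_perms ar F Y"
proof (rule card_subset_eq)
  have "card (basis_perms ar F Y) > 0"
    by (simp add: card_basis_perms[OF F Y fin(2)])
  then show "finite (basis_perms ar F Y)" by (rule card_ge_0_finite)
  show "\<Phi> ` basis_perms ar F X \<subseteq> basis_perms ar F Y"
  proof (rule image_subsetI)
    fix \<gamma> assume \<gamma>: "\<gamma> \<in> basis_perms ar F X"
    then have hom: "\<Phi> \<gamma> \<in> alg_hom ar F F"
      by (intro End_iso_closed[OF \<Phi>]) (simp add: basis_perms_def Aut_def)
    have "bij_betw (\<Phi> \<gamma>) Y Y"
      using pres[OF \<gamma>] fin(2) by (simp add: bij_betw_def finite_surj_inj)
    then obtain \<delta> where \<delta>: "\<delta> \<in> Aut ar F" "\<And>y. y \<in> Y \<Longrightarrow> \<delta> y = \<Phi> \<gamma> y"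
      using bij_extends_to_Aut[OF F Y Y] by blast
    then have "\<Phi> \<gamma> = \<delta>"
      using hom by (intro End_basis_eqI[OF Y]) (auto simp: Aut_def)
    then show "\<Phi> \<gamma> \<in> basis_perms ar F Y"
      using \<delta>(1) pres[OF \<gamma>] by (simp add: basis_perms_def)
  qed
  have "inj_on \<Phi> (basis_perms ar F X)"
    using End_iso_bij[OF \<Phi>]
    by (auto simp: bij_betw_def basis_perms_def Aut_def intro: inj_on_subset)
  then show "card (\<Phi> ` basis_perms ar F X) = card (basis_perms ar F Y)"
    by (simp add: card_image card_basis_perms[OF F X fin(1)] card_basis_perms[OF F Y fin(2)] card)
qed

text \<open>
  The bijection is read off from the constant endomorphisms: if \<open>\<nu>\<close> sends all of \<open>X\<close>
  to \<open>a\<close>, then \<open>\<Phi>(\<nu>)\<close> sends all of \<open>Y\<close> to \<open>s(a)\<close>.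
\<close>

lemma quasi_inner_if_maps_basis_perms_onto:
  assumes F: "is_algebra ar F" and X: "End_basis ar F X" and Y: "End_basis ar F Y"
    and XY: "X = {} \<longleftrightarrow> Y = {}"
    and \<Phi>: "\<Phi> \<in> iso (End_monoid ar F) (End_monoid ar F)"
    and onto: "\<Phi> ` basis_perms ar F X = basis_perms ar F Y"
  shows "quasi_inner ar F \<Phi>"
proof (cases "X = {}")
  case True
  \<comment> \<open>There is only one endomorphism, so conjugation by the identity will do.\<close>
  have "\<Phi> \<nu> = conjugate (carrier F) id \<nu>" if \<nu>: "\<nu> \<in> alg_hom ar F F" for \<nu>
  proof (rule conjugate_eqI)
    have "\<Phi> \<nu> = \<nu>" using True by (intro End_basis_eqI[OF X End_iso_closed[OF \<Phi> \<nu>] \<nu>]) auto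
    then show "\<Phi> \<nu> (id a) = id (\<nu> a)" for a by simp
  qed (use \<nu> alg_hom_apply[OF \<nu>] alg_hom_extensional[OF End_iso_closed[OF \<Phi> \<nu>]] in auto)
  then show ?thesis unfolding quasi_inner_def using bij_betw_id by blast
next
  case False
  then obtain x0 y0 where x0: "x0 \<in> X" and y0: "y0 \<in> Y" using XY by blast
  have sub: "X \<subseteq> carrier F" "Y \<subseteq> carrier F" using X Y by (auto simp: End_basis_def)
  have "\<forall>a \<in> carrier F. \<exists>h \<in> alg_hom ar F F. \<forall>x \<in> X. h x = a"
    using End_basis_extend[OF X] by (metis Pi_I)
  then obtain c where c: "\<And>a. a \<in> carrier F \<Longrightarrow> c a \<in> alg_hom ar F F"
    "\<And>a x. a \<in> carrier F \<Longrightarrow> x \<in> X \<Longrightarrow> c a x = a"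
    by metis
  \<comment> \<open>Invariance under the basis permutations is multiplicative, so \<open>\<Phi>\<close> transports it.\<close>
  have const: "(\<forall>x \<in> X. \<forall>y \<in> X. \<nu> x = \<nu> y) \<longleftrightarrow> (\<forall>x \<in> Y. \<forall>y \<in> Y. \<Phi> \<nu> x = \<Phi> \<nu> y)"
    if \<nu>: "\<nu> \<in> alg_hom ar F F" for \<nu>
  proof -
    have "compose (carrier F) \<nu> \<gamma> = \<nu> \<longleftrightarrow> compose (carrier F) (\<Phi> \<nu>) (\<Phi> \<gamma>) = \<Phi> \<nu>"
      if "\<gamma> \<in> basis_perms ar F X" for \<gamma>
    proof -
      have \<gamma>: "\<gamma> \<in> alg_hom ar F F" using that by (simp add: basis_perms_def Aut_def)
      show ?thesis
        using End_iso_bij[OF \<Phi>] End_iso_compose[OF \<Phi> \<nu> \<gamma>] alg_hom_compose[OF F \<gamma> \<nu>] \<nu>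
        by (metis bij_betw_def inj_on_def)
    qed
    then have "(\<forall>\<gamma> \<in> basis_perms ar F X. compose (carrier F) \<nu> \<gamma> = \<nu>) \<longleftrightarrow>
        (\<forall>\<delta> \<in> basis_perms ar F Y. compose (carrier F) (\<Phi> \<nu>) \<delta> = \<Phi> \<nu>)"
      unfolding onto[symmetric] by auto
    then show ?thesis
      unfolding basis_perms_invariant_iff_constant[OF F X \<nu>]
        basis_perms_invariant_iff_constant[OF F Y End_iso_closed[OF \<Phi> \<nu>]] .
  qed
  define s where "s = (\<lambda>a. \<Phi> (c a) y0)"
  have sF: "s a \<in> carrier F" if "a \<in> carrier F" for a
    using alg_hom_apply[OF End_iso_closed[OF \<Phi> c(1)[OF that]]] y0 sub by (auto simp: s_def)
  have \<Phi>c: "\<Phi> (c a) y = s a" if "a \<in> carrier F" "y \<in> Y" for a y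
  proof -
    have "\<forall>x \<in> X. \<forall>x' \<in> X. c a x = c a x'" using c(2)[OF that(1)] by simp
    then have "\<forall>y \<in> Y. \<forall>y' \<in> Y. \<Phi> (c a) y = \<Phi> (c a) y'"
      by (rule iffD1[OF const[OF c(1)[OF that(1)]]])
    then show ?thesis using that(2) y0 unfolding s_def by blast
  qed
  have cI: "\<nu> = c a" if "\<nu> \<in> alg_hom ar F F" "a \<in> carrier F" "\<And>x. x \<in> X \<Longrightarrow> \<nu> x = a" for \<nu> a
    using that c by (intro End_basis_eqI[OF X]) auto
  have bij: "bij_betw s (carrier F) (carrier F)"
  proof (rule bij_betw_imageI)
    show "inj_on s (carrier F)"
    proof (rule inj_onI)
      fix a b assume ab: "a \<in> carrier F" "b \<in> carrier F" "s a = s b"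
      have "\<Phi> (c a) = \<Phi> (c b)"
        using ab \<Phi>c by (intro End_basis_eqI[OF Y] End_iso_closed[OF \<Phi>] c(1)) auto
      then have "c a = c b"
        using End_iso_bij[OF \<Phi>] c(1) ab by (auto simp: bij_betw_def inj_on_def)
      then show "a = b" using c(2) x0 ab by metis
    qed
    show "s ` carrier F = carrier F"
    proof (intro subset_antisym subsetI)
      fix b assume b: "b \<in> carrier F"
      obtain d where d: "d \<in> alg_hom ar F F" "\<And>y. y \<in> Y \<Longrightarrow> d y = b"
        using End_basis_extend[OF Y, of "\<lambda>_. b"] b by blast
      obtain \<nu> where \<nu>: "\<nu> \<in> alg_hom ar F F" "\<Phi> \<nu> = d"
        using End_iso_bij[OF \<Phi>] d(1) unfolding bij_betw_def by (metis imageE)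
      have a: "\<nu> x0 \<in> carrier F" using alg_hom_apply[OF \<nu>(1)] x0 sub by blast
      have "\<forall>y \<in> Y. \<forall>y' \<in> Y. \<Phi> \<nu> y = \<Phi> \<nu> y'" using \<nu>(2) d(2) by simp
      then have "\<forall>x \<in> X. \<forall>x' \<in> X. \<nu> x = \<nu> x'" by (rule iffD2[OF const[OF \<nu>(1)]])
      then have "\<nu> = c (\<nu> x0)" using x0 by (intro cI[OF \<nu>(1) a]) blast
      then have "s (\<nu> x0) = b" using \<nu>(2) d(2) y0 by (simp add: s_def)
      then show "b \<in> s ` carrier F" using a by blast
    qed (use sF in auto)
  qed
  have "\<Phi> \<nu> = conjugate (carrier F) s \<nu>" if \<nu>: "\<nu> \<in> alg_hom ar F F" for \<nu>
  proof (rule conjugate_eqI[OF bij])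
    fix a assume a: "a \<in> carrier F"
    have "compose (carrier F) \<nu> (c a) = c (\<nu> a)"
      using a c(2) sub by (intro cI alg_hom_compose[OF F c(1)[OF a] \<nu>] alg_hom_apply[OF \<nu>])
        (auto simp: compose_def)
    then have "compose (carrier F) (\<Phi> \<nu>) (\<Phi> (c a)) y0 = s (\<nu> a)"
      using End_iso_compose[OF \<Phi> \<nu> c(1)[OF a]] by (simp add: s_def)
    then show "\<Phi> \<nu> (s a) = s (\<nu> a)" using y0 sub by (auto simp: compose_def s_def)
  qed (use alg_hom_apply[OF \<nu>] alg_hom_extensional[OF End_iso_closed[OF \<Phi> \<nu>]] in auto)
  then show ?thesis unfolding quasi_inner_def using bij by blast
qed

theorem theorem3:
  fixes ar :: "'f \<Rightarrow> nat" and E :: "'f identity set"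
    and F :: "('a, 'f) algebra" and X :: "'a set" and n :: nat
    and \<Phi> :: "('a \<Rightarrow> 'a) \<Rightarrow> ('a \<Rightarrow> 'a)"
  assumes "E \<subseteq> identities ar"
    and "freely_generated ar E F X" and "finite X" and "card X = n"
    and "\<Phi> \<in> iso (End_monoid ar F) (End_monoid ar F)"
  shows "(quasi_inner ar F \<Phi> \<longleftrightarrow> inner_on ar F (basis_perms ar F X) \<Phi>) \<and>
         (inner_on ar F (basis_perms ar F X) \<Phi> \<longleftrightarrow>
           (\<exists>Y. freely_generated ar E F Y \<and> finite Y \<and> card Y = n \<and>
                (\<forall>\<gamma> \<in> basis_perms ar F X. \<Phi> \<gamma> ` Y = Y)))"
    (is "(?qi \<longleftrightarrow> ?inn) \<and> (?inn \<longleftrightarrow> ?basis)")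
proof -
  have F: "is_algebra ar F" using assms(2) by (simp add: freely_generated_def in_variety_def)
  note X = freely_generated_End_basis[OF assms(1,2)]
  have "?inn" if ?qi
    by (rule quasi_inner_imp_inner_on_basis_perms[OF F X assms(5) that])
  moreover have "?basis" if inn: ?inn
  proof -
    obtain \<sigma> where \<sigma>: "\<sigma> \<in> Aut ar F"
      "\<And>\<gamma>. \<gamma> \<in> basis_perms ar F X \<Longrightarrow> \<Phi> \<gamma> = conjugate (carrier F) \<sigma> \<gamma>"
      using inn unfolding inner_on_def by blast
    have "inj_on \<sigma> X"
      using \<sigma>(1) X by (auto simp: Aut_def bij_betw_def End_basis_def intro: inj_on_subset)
    then have "card (\<sigma> ` X) = n" using assms(4) by (simp add: card_image)
    moreover have "\<Phi> \<gamma> ` (\<sigma> ` X) = \<sigma> ` X" if "\<gamma> \<in> basis_perms ar F X" for \<gamma>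
      using conjugate_basis_perm_preserves_image[OF X \<sigma>(1) that] \<sigma>(2)[OF that] by simp
    ultimately show ?thesis
      using freely_generated_Aut_image[OF assms(2) \<sigma>(1)] assms(3) by blast
  qed
  moreover have "?qi" if basis: ?basis
  proof -
    obtain Y where Y: "freely_generated ar E F Y" "finite Y" "card Y = n"
      "\<And>\<gamma>. \<gamma> \<in> basis_perms ar F X \<Longrightarrow> \<Phi> \<gamma> ` Y = Y"
      using basis by blast
    note Y' = freely_generated_End_basis[OF assms(1) Y(1)]
    have "X = {} \<longleftrightarrow> Y = {}" using assms(3,4) Y(2,3) by auto
    moreover have "\<Phi> ` basis_perms ar F X = basis_perms ar F Y"
      using End_iso_maps_basis_perms_onto[OF F X Y' assms(3) Y(2) _ assms(5) Y(4)] assms(4) Y(3)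
      by simp
    ultimately show ?thesis
      by (rule quasi_inner_if_maps_basis_perms_onto[OF F X Y' _ assms(5)])
  qed
  ultimately show ?thesis by blast
qed

end
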